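(* Assume that the linear system $\dot x=L(t)x$ is exponentially stable, and let $$A_t=\Big\{\rho\int_{-\infty}^t\Psi(t,s)\xi(s)\,ds : \xi\in\mathcal{U}\Big\},\qquad t\in\mathbb{R}.$$ Then $A_t$ is strictly convex for every $t\in\mathbb{R}$.
   Context: Let $d\ge2$, $\rho>0$, $L:\mathbb{R}\to\mathbb{R}^{d\times d}$ locally integrable, and $\mathcal{U}=\{\xi\in L^\infty(\mathbb{R},\mathbb{R}^d):\|\xi\|_\infty\le1\}$. $\Psi(t,s)$ is the principal matrix solution of $\dot x=L(t)x$ at $s$ (i.e. $\Psi(s,s)=I$). Exponential stability means: there are $K\ge1$, $\gamma>0$ with $\|\Psi(t,s)\|\le Ke^{-\gamma(t-s)}$ for all $t\ge s$. A set is strictly convex if it is convex and the open segment between any two distinct points of it lies in its interior. *)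

theory Defs
  imports "HOL-Analysis.Analysis" "HOL-Probability.Essential_Supremum"
begin

definition locally_integrable :: "(real \<Rightarrow> 'a::euclidean_space) \<Rightarrow> bool" where
  "locally_integrable f \<longleftrightarrow> (\<forall>a b. f absolutely_integrable_on {a..b})"

(* The usual epsilon-delta definition; a finite family of non-overlapping compact
   intervals is a division of its own union, and an interval K is [Inf K, Sup K]. *)
definition absolutely_continuous_on ::
    "real set \<Rightarrow> (real \<Rightarrow> 'a::real_normed_vector) \<Rightarrow> bool" where
  "absolutely_continuous_on S f \<longleftrightarrow>
     (\<forall>\<epsilon>>0. \<exists>\<delta>>0. \<forall>\<D>.
        \<D> division_of \<Union>\<D> \<and> \<Union>\<D> \<subseteq> S \<and> (\<Sum>K\<in>\<D>. Sup K - Inf K) < \<delta> \<longrightarrow>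
        (\<Sum>K\<in>\<D>. norm (f (Sup K) - f (Inf K))) < \<epsilon>)"

(* L is only locally integrable, so solutions of X' = L(t) X are understood in the
   sense of Caratheodory: locally absolutely continuous, with the differential
   equation holding almost everywhere. *)
definition matrix_solution ::
    "(real \<Rightarrow> real^'n^'n) \<Rightarrow> (real \<Rightarrow> real^'n^'n) \<Rightarrow> bool" where
  "matrix_solution L X \<longleftrightarrow>
     (\<forall>a b. absolutely_continuous_on {a..b} X) \<and>
     (AE t in lebesgue. (X has_vector_derivative (L t ** X t)) (at t))"

definition principal_matrix_solution ::
    "(real \<Rightarrow> real^'n^'n) \<Rightarrow> (real \<Rightarrow> real \<Rightarrow> real^'n^'n) \<Rightarrow> bool" where
  "principal_matrix_solution L \<Psi> \<longleftrightarrow>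
     (\<forall>s. matrix_solution L (\<lambda>t. \<Psi> t s) \<and> \<Psi> s s = mat 1)"

(* Here \<Psi> is the principal matrix solution of the system; the matrix norm is the
   operator norm induced by the Euclidean norm. *)
definition exponentially_stable :: "(real \<Rightarrow> real \<Rightarrow> real^'n^'n) \<Rightarrow> bool" where
  "exponentially_stable \<Psi> \<longleftrightarrow>
     (\<exists>K \<gamma>. K \<ge> 1 \<and> \<gamma> > 0 \<and>
        (\<forall>s t. s \<le> t \<longrightarrow> onorm ((*v) (\<Psi> t s)) \<le> K * exp (- \<gamma> * (t - s))))"

(* Functions instead of classes modulo null sets: only integrals of \<xi> are used. *)
definition admissible :: "(real \<Rightarrow> real^'n) set" where
  "admissible =
     {\<xi>. \<xi> \<in> borel_measurable lebesgue \<and> esssup lebesgue (\<lambda>s. ereal (norm (\<xi> s))) \<le> 1}"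

definition strictly_convex :: "'a::real_normed_vector set \<Rightarrow> bool" where
  "strictly_convex S \<longleftrightarrow>
     convex S \<and> (\<forall>x\<in>S. \<forall>y\<in>S. x \<noteq> y \<longrightarrow> open_segment x y \<subseteq> interior S)"

end

(* Caratheodory solutions satisfy the integral equation, which gives uniqueness, the cocycle
   identity, and hence the invertibility of \<Psi> t s and its continuity in s.

   For strict convexity, let z be the point of the reachable set given by a proper convex combination
   \<zeta> of \<xi> and \<eta>. Where \<xi> and \<eta> differ, \<zeta> lies in the open unit ball, because the
   Euclidean ball is strictly convex; if \<xi> and \<eta> give different points, then norm (\<zeta> s) is at most
   1 - 1/(n+1) on some non-null set E. Adding to \<zeta> a small multiple of the indicator of E times
   the transpose of \<Psi> t s applied to v keeps it admissible and moves z by a multiple of M v, where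
   M is the integral over E of \<Psi> t s times its transpose. As M is positive definite, z is an
   interior point. *)
theory Submission
  imports Defs
begin

section \<open>Integrating the derivative of an absolutely continuous function\<close>

text \<open>The gauge at points of \<open>N\<close> confines their intervals to an open superset of small measure, so
  absolute continuity bounds the increments of \<open>f\<close> over them; elsewhere the gauge is the usual one.\<close>

lemma has_integral_absolutely_continuous_derivative:
  fixes f :: "real \<Rightarrow> 'a::banach"
  assumes "a \<le> b" and ac: "absolutely_continuous_on {a..b} f" and N: "negligible N"
    and der: "\<And>x. x \<in> {a..b} - N \<Longrightarrow> (f has_vector_derivative f' x) (at x within {a..b})"
  shows "(f' has_integral (f b - f a)) {a..b}"
proof -
  \<comment> \<open>With the value 0 on \<open>N\<close>, tags in \<open>N\<close> contribute
    nothing to a Riemann sum. As \<open>N\<close> is negligible, \<open>g\<close> and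
    \<open>f'\<close> have the same integral.\<close>
  define g where "g = (\<lambda>x. if x \<in> N then 0 else f' x)"
  have "(g has_integral (f b - f a)) (cbox a b)"
    unfolding has_integral
  proof safe
    fix e :: real
    assume "e > 0"
    \<comment> \<open>The extra 1 keeps \<open>c\<close> positive when \<open>a = b\<close>. One
      half of \<open>e\<close> goes to the derivative estimate, summed with slope error
      \<open>\<eta>\<close>, the other half to the intervals tagged in \<open>N\<close>.\<close>
    define c where "c = b - a + 1"
    have "c > 0" using \<open>a \<le> b\<close> by (simp add: c_def)
    define \<eta> where "\<eta> = e / (2 * c)"
    have "\<eta> > 0" using \<open>e > 0\<close> \<open>c > 0\<close> by (simp add: \<eta>_def)
    then have "\<forall>x. \<exists>d>0. x \<in> {a..b} - N \<longrightarrow>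
         (\<forall>y\<in>{a..b}. norm (y-x) < d \<longrightarrow> norm (f y - f x - (y-x) *\<^sub>R f' x) \<le> \<eta> * norm (y-x))"
      using der[unfolded has_vector_derivative_def has_derivative_within_alt] by (metis zero_less_one)
    then obtain d where d: "\<And>x. 0 < d x"
      "\<And>x y. \<lbrakk>x \<in> {a..b} - N; y \<in> {a..b}; norm (y-x) < d x\<rbrakk>
                        \<Longrightarrow> norm (f y - f x - (y-x) *\<^sub>R f' x) \<le> \<eta> * norm (y-x)"
      by metis
    obtain \<delta> where "\<delta> > 0" and \<delta>: "\<And>\<D>. \<lbrakk>\<D> division_of \<Union>\<D>; \<Union>\<D> \<subseteq> {a..b}; (\<Sum>K\<in>\<D>. Sup K - Inf K) < \<delta>\<rbrakk> \<Longrightarrow>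
        (\<Sum>K\<in>\<D>. norm (f (Sup K) - f (Inf K))) < e / 2"
      using ac \<open>e > 0\<close> unfolding absolutely_continuous_on_def by (meson half_gt_zero)
    obtain U where U: "open U" "N \<subseteq> U" "U - N \<in> lmeasurable" "emeasure lebesgue (U - N) < ennreal \<delta>"
      using sets_lebesgue_outer_open[OF negligible_imp_sets[OF N] \<open>\<delta> > 0\<close>] by blast
    have U_eq: "U = (U - N) \<union> N" using U by blast
    have "U \<in> lmeasurable"
      using U(3) negligible_imp_measurable[OF N] U_eq fmeasurable.Un by metis
    have "measure lebesgue U \<le> measure lebesgue (U - N) + measure lebesgue N"
      using U(3) negligible_imp_measurable[OF N] U_eq
      by (metis fmeasurableD measure_Un_le)
    also have "\<dots> = measure lebesgue (U - N)" using N by (simp add: negligible_imp_measure0)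
    also have "\<dots> < \<delta>"
      using U(3,4) \<open>\<delta> > 0\<close> by (simp add: emeasure_eq_measure2 ennreal_less_iff)
    finally have mU: "measure lebesgue U < \<delta>" .
    have "\<forall>x. \<exists>r>0. x \<in> U \<longrightarrow> ball x r \<subseteq> U"
      using \<open>open U\<close> by (metis open_contains_ball zero_less_one)
    then obtain r where r: "\<And>x. r x > 0" "\<And>x. x \<in> U \<Longrightarrow> ball x (r x) \<subseteq> U" by metis
    define \<gamma> where "\<gamma> = (\<lambda>x. ball x (if x \<in> N then r x else d x))"
    have "gauge \<gamma>" unfolding \<gamma>_def by (rule gauge_ball_dependent) (use d r in auto)
    have main: "norm ((\<Sum>(x, k)\<in>p. measure lborel k *\<^sub>R g x) - (f b - f a)) < e"
      if p: "p tagged_division_of cbox a b" and fine: "\<gamma> fine p" for p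
    proof -
      note p' = tagged_division_ofD[OF p]
      have ba: "b - a = (\<Sum>(x,K)\<in>p. Sup K - Inf K)" "f b - f a = (\<Sum>(x,K)\<in>p. f(Sup K) - f(Inf K))"
        using additive_tagged_division_1[where f= "\<lambda>x. x"] additive_tagged_division_1[where f= f]
            \<open>a \<le> b\<close> p by auto
      \<comment> \<open>The intervals tagged in \<open>N\<close> do not overlap and lie in
        \<open>U\<close>, so their total length is less than \<open>\<delta>\<close> and absolute
        continuity bounds the increments of \<open>f\<close> over them.\<close>
      define q where "q = {z \<in> p. fst z \<in> N}"
      have "q \<subseteq> p" by (auto simp: q_def)
      have q: "q tagged_division_of \<Union>(snd ` q)"
        using p \<open>q \<subseteq> p\<close> tagged_partial_division_of_Union_self tagged_partial_division_subset
        by (metis tagged_division_of_def)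
      have qd: "snd ` q division_of \<Union>(snd ` q)"
        by (rule division_of_tagged_division[OF q])
      have "\<Union>(snd ` q) \<subseteq> {a..b}" using \<open>q \<subseteq> p\<close> p'(3) by fastforce
      have "\<Union>(snd ` q) \<subseteq> U"
      proof safe
        fix x K y assume "(x, K) \<in> q" "y \<in> snd (x, K)"
        then have "x \<in> N" "K \<subseteq> \<gamma> x" "y \<in> K"
          using fine by (auto simp: q_def fine_def)
        then show "y \<in> U" using r(2)[of x] U(2) by (auto simp: \<gamma>_def)
      qed
      have "(\<Sum>K\<in>snd ` q. Sup K - Inf K) = (\<Sum>K\<in>snd ` q. measure lebesgue K)"
      proof (rule sum.cong)
        fix K assume "K \<in> snd ` q"
        then obtain u v where "K = cbox u v" "K \<noteq> {}" using division_ofD(3,4)[OF qd] by metis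
        then show "Sup K - Inf K = measure lebesgue K" by auto
      qed simp
      also have "\<dots> = measure lebesgue (\<Union>(snd ` q))" by (rule content_division[OF qd])
      also have "\<dots> \<le> measure lebesgue U"
        using \<open>\<Union>(snd ` q) \<subseteq> U\<close> \<open>U \<in> lmeasurable\<close> lmeasurable_division[OF qd]
        by (intro measure_mono_fmeasurable) auto
      finally have "(\<Sum>K\<in>snd ` q. norm (f (Sup K) - f (Inf K))) < e / 2"
        using mU \<delta>[OF qd \<open>\<Union>(snd ` q) \<subseteq> {a..b}\<close>] by linarith
      \<comment> \<open>Absolute continuity speaks of intervals without tags. Different tags can
        share an interval only if it has empty interior, and then it contributes 0 to both
        sums.\<close>
      moreover have "(\<Sum>(x, K)\<in>q. norm (f (Sup K) - f (Inf K))) = (\<Sum>K\<in>snd ` q. norm (f (Sup K) - f (Inf K)))"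
      proof -
        \<comment> \<open>\<open>Sup {}\<close> and \<open>Inf {}\<close> need not coincide, so the empty interval is excluded by hand.\<close>
        let ?d = "\<lambda>K. if K = {} then 0 else norm (f (Sup K) - f (Inf K))"
        have "(\<Sum>(x, K)\<in>q. norm (f (Sup K) - f (Inf K))) = (\<Sum>(x, K)\<in>q. ?d K)"
          using tagged_division_ofD(2)[OF q] by (intro sum.cong refl) fastforce
        also have "\<dots> = (\<Sum>K\<in>snd ` q. ?d K)"
          by (rule sum.over_tagged_division_lemma[OF q]) (auto simp: not_less le_less)
        also have "\<dots> = (\<Sum>K\<in>snd ` q. norm (f (Sup K) - f (Inf K)))"
          using division_ofD(3)[OF qd] by (intro sum.cong) auto
        finally show ?thesis .
      qed
      ultimately have q2: "(\<Sum>(x, K)\<in>q. norm (f (Sup K) - f (Inf K))) < e / 2" by simp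
      have "norm ((\<Sum>(x, k)\<in>p. measure lborel k *\<^sub>R g x) - (f b - f a))
          = norm (\<Sum>(x, K)\<in>p. measure lborel K *\<^sub>R g x - (f (Sup K) - f (Inf K)))"
        unfolding ba(2) by (simp add: sum_subtractf[symmetric] split_def)
      \<comment> \<open>A tag outside \<open>N\<close> costs \<open>\<eta>\<close> times the length,
        by the derivative estimate at both endpoints. A tag in \<open>N\<close>, where
        \<open>g\<close> vanishes, costs the increment of \<open>f\<close>.\<close>
      also have "\<dots> \<le> (\<Sum>z\<in>p. (case z of (x, K) \<Rightarrow> \<eta> * (Sup K - Inf K)) +
           (if z \<in> q then case z of (x, K) \<Rightarrow> norm (f (Sup K) - f (Inf K)) else 0))"
      proof (rule sum_norm_le, safe)
        fix x K
        assume xK: "(x, K) \<in> p"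
        then obtain u v where K: "K = cbox u v" using p'(4) by metis
        have "x \<in> K" "K \<subseteq> {a..b}" using p'(2,3)[OF xK] by auto
        then have "u \<le> x" "x \<le> v" "u \<le> v" "u \<in> {a..b}" "v \<in> {a..b}" "x \<in> {a..b}" unfolding K by auto
        then have S: "Sup K = v" "Inf K = u" "measure lborel K = v - u" unfolding K by auto
        show "norm (measure lborel K *\<^sub>R g x - (f (Sup K) - f (Inf K)))
          \<le> \<eta> * (Sup K - Inf K) + (if (x, K) \<in> q then norm (f (Sup K) - f (Inf K)) else 0)"
        proof (cases "x \<in> N")
          case True
          then have "(x, K) \<in> q" using xK by (simp add: q_def)
          then show ?thesis using True \<open>u \<le> v\<close> \<open>\<eta> > 0\<close> by (simp add: g_def S norm_minus_commute)
        next
          case False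
          have "K \<subseteq> ball x (d x)" using bspec[OF fine[unfolded fine_def] xK] False by (simp add: \<gamma>_def)
          then have "u \<in> ball x (d x)" "v \<in> ball x (d x)" using \<open>u \<le> v\<close> by (auto simp: K)
          then have 1: "norm (f u - f x - (u-x) *\<^sub>R f' x) \<le> \<eta> * norm (u-x)"
             and 2: "norm (f v - f x - (v-x) *\<^sub>R f' x) \<le> \<eta> * norm (v-x)"
            using d(2)[of x] False \<open>u \<in> {a..b}\<close> \<open>v \<in> {a..b}\<close> \<open>x \<in> {a..b}\<close>
            by (auto simp: dist_norm norm_minus_commute)
          have "norm ((v - u) *\<^sub>R f' x - (f v - f u)) = norm (f u - f x - (u - x) *\<^sub>R f' x - (f v - f x - (v - x) *\<^sub>R f' x))"
            by (auto simp: algebra_simps)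
          also have "\<dots> \<le> norm (f u - f x - (u - x) *\<^sub>R f' x) + norm (f v - f x - (v - x) *\<^sub>R f' x)"
            by (rule norm_triangle_ineq4)
          also have "\<dots> \<le> \<eta> * norm (u-x) + \<eta> * norm (v-x)" using 1 2 by linarith
          also have "\<dots> = \<eta> * (v - u)" using \<open>u \<le> x\<close> \<open>x \<le> v\<close> by (simp add: algebra_simps)
          finally show ?thesis using False by (simp add: S g_def q_def)
        qed
      qed
      also have "\<dots> = \<eta> * (b - a) + (\<Sum>(x, K)\<in>q. norm (f (Sup K) - f (Inf K)))"
        using p'(1) \<open>q \<subseteq> p\<close> unfolding ba(1)
        by (simp add: sum.distrib sum_distrib_left split_def sum.If_cases Int_absorb1 flip: sum.inter_restrict)
      also have "\<dots> < \<eta> * (b - a + 1) + e / 2"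
        using q2 \<open>\<eta> > 0\<close> by (simp add: algebra_simps)
      also have "\<dots> = e" using \<open>c > 0\<close> by (simp add: \<eta>_def flip: c_def)
      finally show ?thesis .
    qed
    show "\<exists>\<gamma>. gauge \<gamma> \<and> (\<forall>\<D>. \<D> tagged_division_of cbox a b \<and> \<gamma> fine \<D> \<longrightarrow>
        norm ((\<Sum>(x, k)\<in>\<D>. measure lborel k *\<^sub>R g x) - (f b - f a)) < e)"
      using \<open>gauge \<gamma>\<close> main by (intro exI[of _ \<gamma>] conjI allI impI) simp_all
  qed
  then have "(f' has_integral (f b - f a)) (cbox a b)"
    by (rule has_integral_spike[OF N, rotated]) (auto simp: g_def)
  then show ?thesis by simp
qed

lemma absolutely_continuous_on_imp_continuous_on:
  fixes f :: "real \<Rightarrow> 'a::real_normed_vector"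
  assumes "absolutely_continuous_on {a..b} f"
  shows "continuous_on {a..b} f"
  unfolding continuous_on_iff
proof safe
  fix x e :: real
  assume x: "x \<in> {a..b}" and "e > 0"
  then obtain \<delta> where "\<delta> > 0" and \<delta>: "\<And>\<D>. \<lbrakk>\<D> division_of \<Union>\<D>; \<Union>\<D> \<subseteq> {a..b}; (\<Sum>K\<in>\<D>. Sup K - Inf K) < \<delta>\<rbrakk> \<Longrightarrow>
        (\<Sum>K\<in>\<D>. norm (f (Sup K) - f (Inf K))) < e"
    using assms unfolding absolutely_continuous_on_def by meson
  have "norm (f v - f u) < e" if "u \<le> v" "v - u < \<delta>" "u \<in> {a..b}" "v \<in> {a..b}" for u v
    using \<delta>[of "{{u..v}}"] that division_of_self[of u v] by auto
  then show "\<exists>d>0. \<forall>x'\<in>{a..b}. dist x' x < d \<longrightarrow> dist (f x') (f x) < e"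
    using x \<open>\<delta> > 0\<close> by (intro exI[of _ \<delta>]) (smt (verit) dist_norm norm_minus_commute real_norm_def)
qed

section \<open>Uniqueness for linear integral equations\<close>

text \<open>The zero set of \<open>f\<close> is clopen: near a zero, the maximum of \<open>norm f\<close> on an interval over which
  \<open>norm L\<close> has small integral is at most half of itself.\<close>

lemma integral_equation_eq_0:
  fixes f :: "real \<Rightarrow> 'a::banach" and L :: "real \<Rightarrow> 'b::euclidean_space"
    and B :: "'b \<Rightarrow> 'a \<Rightarrow> 'a"
  assumes B: "bounded_bilinear B" and L: "\<And>a b. L absolutely_integrable_on {a..b}"
    and cont: "continuous_on UNIV f"
    and eq: "\<And>a b. a \<le> b \<Longrightarrow> ((\<lambda>t. B (L t) (f t)) has_integral (f b - f a)) {a..b}"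
    and "f s = 0"
  shows "f t = 0"
proof -
  obtain C where "C > 0" and C: "\<And>x y. norm (B x y) \<le> norm x * norm y * C"
    using bounded_bilinear.pos_bounded[OF B] by blast
  have Ln: "(\<lambda>t. norm (L t)) integrable_on {a..b}" for a b
    using L[of a b] by (simp add: absolutely_integrable_on_def)
  let ?Z = "{t. f t = 0}"
  have "closed ?Z"
    using cont by (intro closed_Collect_eq) auto
  moreover have "open ?Z"
    unfolding open_contains_ball
  proof safe
    fix t0 assume f0: "f t0 = 0"
    \<comment> \<open>Starting at \<open>t0 - 1\<close> lets \<open>G\<close> cover both sides of
      \<open>t0\<close>. A deviation below \<open>1 / (4 * C)\<close> on each side gives the bound
      \<open>1 / 2\<close> in \<open>small\<close>.\<close>
    define G where "G = (\<lambda>t. integral {t0 - 1..t} (\<lambda>t. norm (L t)))"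
    have "continuous_on {t0 - 1..t0 + 1} G"
      unfolding G_def by (rule indefinite_integral_continuous_1[OF Ln])
    then have "\<exists>h>0. \<forall>t\<in>{t0 - 1..t0 + 1}. dist t t0 < h \<longrightarrow> dist (G t) (G t0) < 1 / (4 * C)"
      unfolding continuous_on_iff using \<open>C > 0\<close> by simp
    then obtain h where "h > 0" and
      h: "\<And>t. t \<in> {t0 - 1..t0 + 1} \<Longrightarrow> dist t t0 < h \<Longrightarrow> dist (G t) (G t0) < 1 / (4 * C)"
      by blast
    \<comment> \<open>Halving \<open>h\<close> gives \<open>k < h\<close>, as the strict distance
      condition in \<open>h\<close> demands; \<open>k \<le> 1\<close> keeps the interval inside the
      domain of \<open>G\<close>.\<close>
    define k where "k = min (h / 2) 1"
    have k: "0 < k" "k < h" "k \<le> 1" using \<open>h > 0\<close> by (auto simp: k_def)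
    have "integral {t0 - k..t0 + k} (\<lambda>t. norm (L t)) = G (t0 + k) - G (t0 - k)"
      unfolding G_def using k Ln
      by (simp add: Henstock_Kurzweil_Integration.integral_combine[of "t0 - 1" "t0 - k" "t0 + k", symmetric])
    also have "\<dots> < 1 / (2 * C)"
      using h[of "t0 + k"] h[of "t0 - k"] k by (simp add: dist_real_def)
    finally have small: "C * integral {t0 - k..t0 + k} (\<lambda>t. norm (L t)) \<le> 1 / 2"
      using \<open>C > 0\<close> by (simp add: field_simps)
    have "continuous_on {t0 - k..t0 + k} (\<lambda>t. norm (f t))"
      by (intro continuous_on_norm continuous_on_subset[OF cont]) auto
    then obtain t1 where t1: "t1 \<in> {t0 - k..t0 + k}"
      and max: "\<And>t. t \<in> {t0 - k..t0 + k} \<Longrightarrow> norm (f t) \<le> norm (f t1)"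
      using continuous_attains_sup[of "{t0 - k..t0 + k}" "\<lambda>t. norm (f t)"] k by auto
    have main: "norm (f v - f u) \<le> norm (f t1) / 2"
      if "u \<le> v" "t0 - k \<le> u" "v \<le> t0 + k" for u v
    proof -
      have "norm (f v - f u) = norm (integral {u..v} (\<lambda>t. B (L t) (f t)))"
        using eq[OF \<open>u \<le> v\<close>] by (simp add: integral_unique)
      also have "\<dots> \<le> integral {u..v} (\<lambda>t. C * norm (f t1) * norm (L t))"
      proof (rule integral_norm_bound_integral)
        show "(\<lambda>t. B (L t) (f t)) integrable_on {u..v}" using eq[OF \<open>u \<le> v\<close>] by blast
        show "(\<lambda>t. C * norm (f t1) * norm (L t)) integrable_on {u..v}"
          by (intro integrable_on_mult_right Ln)
        fix t assume "t \<in> {u..v}"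
        then have "norm (f t) \<le> norm (f t1)" using that by (intro max) auto
        then have "norm (L t) * norm (f t) * C \<le> norm (L t) * norm (f t1) * C"
          using \<open>C > 0\<close> by (intro mult_right_mono mult_left_mono) auto
        then show "norm (B (L t) (f t)) \<le> C * norm (f t1) * norm (L t)"
          using C[of "L t" "f t"] by (simp add: mult_ac)
      qed
      also have "\<dots> = C * norm (f t1) * integral {u..v} (\<lambda>t. norm (L t))" by simp
      also have "\<dots> \<le> C * norm (f t1) * integral {t0 - k..t0 + k} (\<lambda>t. norm (L t))"
        using that \<open>C > 0\<close> by (intro mult_left_mono integral_subset_le Ln) auto
      also have "\<dots> \<le> norm (f t1) / 2"
        using mult_left_mono[OF small norm_ge_zero[of "f t1"]] by (simp add: mult_ac)
      finally show ?thesis .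
    qed
    \<comment> \<open>Since \<open>f t0 = 0\<close>, the increment of \<open>f\<close> between
      \<open>t0\<close> and \<open>t1\<close> is \<open>f t1\<close> up to sign.\<close>
    have "norm (f t1) \<le> norm (f t1) / 2"
    proof (cases "t1 \<le> t0")
      case True
      then show ?thesis using main[of t1 t0] t1 k f0 by simp
    next
      case False
      then show ?thesis using main[of t0 t1] t1 k f0 by simp
    qed
    then have "norm (f t1) \<le> 0" by simp
    then have "f t = 0" if "t \<in> {t0 - k..t0 + k}" for t
      using max[OF that] by (metis norm_le_zero_iff order_trans)
    then show "\<exists>e>0. ball t0 e \<subseteq> ?Z"
      using k by (intro exI[of _ k]) (auto simp: dist_real_def abs_less_iff)
  qed
  ultimately have "?Z = UNIV"
    using \<open>f s = 0\<close> clopen[of ?Z] by blast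
  then show ?thesis by blast
qed

section \<open>Caratheodory solutions, the cocycle identity and inverses\<close>

lemma bounded_bilinear_matrix_matrix_mult:
  "bounded_bilinear ((**) :: real^'n^'m \<Rightarrow> real^'p^'n \<Rightarrow> real^'p^'m)"
  unfolding bilinear_conv_bounded_bilinear[symmetric] bilinear_def
  by (auto intro!: linearI simp: vec_eq_iff matrix_matrix_mult_def sum.distrib sum_distrib_left
      distrib_left distrib_right mult.assoc mult.left_commute)

lemma bounded_bilinear_matrix_vector_mult:
  "bounded_bilinear ((*v) :: real^'n^'m \<Rightarrow> real^'n \<Rightarrow> real^'m)"
  unfolding bilinear_conv_bounded_bilinear[symmetric] bilinear_def
  by (auto intro!: linearI simp: matrix_vector_mult_add_rdistrib matrix_vector_right_distrib
      matrix_vector_mult_scaleR scaleR_matrix_vector_assoc)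

text \<open>Absolute continuity lets the almost everywhere derivative integrate back to the
  increment. Uniqueness is then proved from this equation and continuity alone.\<close>

lemma matrix_solution_integral_equation:
  fixes X :: "real \<Rightarrow> real^'n^'n"
  assumes "matrix_solution L X" "a \<le> b"
  shows "((\<lambda>t. L t ** X t) has_integral (X b - X a)) {a..b}"
proof -
  obtain N where N: "N \<in> null_sets lebesgue"
    and der: "\<And>t. t \<notin> N \<Longrightarrow> (X has_vector_derivative (L t ** X t)) (at t)"
    using assms(1) unfolding matrix_solution_def by (fastforce elim!: AE_E3)
  show ?thesis
    using assms N der
    by (intro has_integral_absolutely_continuous_derivative[of _ _ _ N])
      (auto simp: matrix_solution_def negligible_iff_null_sets intro: has_vector_derivative_at_within)
qed

lemma matrix_solution_continuous:
  fixes X :: "real \<Rightarrow> real^'n^'n"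
  assumes "matrix_solution L X"
  shows "continuous_on UNIV X"
proof (rule continuous_at_imp_continuous_on, rule ballI)
  fix t
  have "continuous_on {t - 1..t + 1} X"
    using assms by (auto simp: matrix_solution_def intro: absolutely_continuous_on_imp_continuous_on)
  then show "isCont X t"
    by (rule continuous_on_interior) simp
qed

text \<open>Right multiplication by a constant matrix preserves the linear integral equation, so
  \<open>X t - Y t ** C\<close> satisfies it and vanishes at \<open>s\<close>. The factor
  \<open>C\<close> makes the cocycle identity a direct instance.\<close>

lemma matrix_solution_unique:
  fixes X :: "real \<Rightarrow> real^'n^'n"
  assumes L: "locally_integrable L" and X: "matrix_solution L X" and Y: "matrix_solution L Y"
    and "X s = Y s ** C"
  shows "X t = Y t ** C"
proof -
  interpret bounded_bilinear "(**) :: real^'n^'n \<Rightarrow> real^'n^'n \<Rightarrow> real^'n^'n"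
    by (rule bounded_bilinear_matrix_matrix_mult)
  have "X t - Y t ** C = 0"
  proof (rule integral_equation_eq_0[where f = "\<lambda>t. X t - Y t ** C" and L = L])
    show "bounded_bilinear ((**) :: real^'n^'n \<Rightarrow> real^'n^'n \<Rightarrow> real^'n^'n)"
      by (rule bounded_bilinear_matrix_matrix_mult)
    show "L absolutely_integrable_on {a..b}" for a b
      using L by (simp add: locally_integrable_def)
    show "continuous_on UNIV (\<lambda>t. X t - Y t ** C)"
      using matrix_solution_continuous[OF X] matrix_solution_continuous[OF Y]
      by (intro continuous_intros continuous_on)
    show "((\<lambda>t. L t ** (X t - Y t ** C)) has_integral (X b - Y b ** C - (X a - Y a ** C))) {a..b}"
      if "a \<le> b" for a b
    proof -
      have "((\<lambda>t. (L t ** Y t) ** C) has_integral ((Y b - Y a) ** C)) {a..b}"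
        using has_integral_linear[OF matrix_solution_integral_equation[OF Y that] bounded_linear_left[of C]]
        by (simp add: o_def)
      from has_integral_diff[OF matrix_solution_integral_equation[OF X that] this]
      show ?thesis by (simp add: diff_left diff_right matrix_mul_assoc algebra_simps)
    qed
    show "X s - Y s ** C = 0" using assms(4) by simp
  qed
  then show ?thesis by simp
qed

text \<open>As functions of \<open>t\<close>, both sides solve the same system, and they agree at
  \<open>t = s\<close>.\<close>

lemma principal_matrix_solution_cocycle:
  fixes \<Psi> :: "real \<Rightarrow> real \<Rightarrow> real^'n^'n"
  assumes "locally_integrable L" "principal_matrix_solution L \<Psi>"
  shows "\<Psi> t s ** \<Psi> s r = \<Psi> t r"
  using matrix_solution_unique[OF assms(1), of "\<lambda>t. \<Psi> t r" "\<lambda>t. \<Psi> t s" s "\<Psi> s r" t] assms(2)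
  by (simp add: principal_matrix_solution_def)

lemma principal_matrix_solution_inverse:
  fixes \<Psi> :: "real \<Rightarrow> real \<Rightarrow> real^'n^'n"
  assumes "locally_integrable L" "principal_matrix_solution L \<Psi>"
  shows "\<Psi> t s ** \<Psi> s t = mat 1"
  using principal_matrix_solution_cocycle[OF assms, of t s t] assms(2)
  by (simp add: principal_matrix_solution_def)

section \<open>Continuity in the initial time\<close>

lemma continuous_on_det:
  fixes X :: "'a::topological_space \<Rightarrow> real^'n^'n"
  assumes "\<And>i j. continuous_on S (\<lambda>s. X s $ i $ j)"
  shows "continuous_on S (\<lambda>s. det (X s))"
  unfolding det_def by (intro continuous_intros assms)

text \<open>By Cramer's rule the entries of \<open>Y\<close> are quotients of determinants that
  depend continuously on \<open>X\<close>; the denominator \<open>det (X s)\<close> is nonzero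
  because \<open>X s\<close> has a right inverse.\<close>

lemma continuous_on_right_inverse_matrix:
  fixes X Y :: "'a::topological_space \<Rightarrow> real^'n^'n"
  assumes X: "continuous_on S X" and XY: "\<And>s. s \<in> S \<Longrightarrow> X s ** Y s = mat 1"
  shows "continuous_on S Y"
proof -
  have nz: "det (X s) \<noteq> 0" if "s \<in> S" for s
    using XY[OF that] by (metis det_I det_mul mult_zero_left zero_neq_one)
  \<comment> \<open>Entry \<open>(k, l)\<close> is component \<open>k\<close> of the solution of
    \<open>X s *v x = axis l 1\<close>: column \<open>k\<close> of \<open>X s\<close> is replaced by
    \<open>axis l 1\<close>.\<close>
  define Z :: "'a \<Rightarrow> real^'n^'n"
    where "Z = (\<lambda>s. \<chi> k l. det (\<chi> i j. if j = k then axis l 1 $ i else X s $ i $ j) / det (X s))"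
  have "Y s $ k $ l = Z s $ k $ l" if "s \<in> S" for s k l
  proof -
    have "X s *v (Y s *v axis l 1) = axis l 1"
      by (simp add: matrix_vector_mul_assoc XY that)
    then have "(Y s *v axis l 1) $ k = Z s $ k $ l"
      using cramer[OF nz[OF that], of "Y s *v axis l 1" "axis l 1"] by (simp add: Z_def)
    then show ?thesis by (simp add: matrix_vector_mult_basis column_def)
  qed
  then have "Y s = Z s" if "s \<in> S" for s
    using that by (simp add: vec_eq_iff)
  moreover have "continuous_on S Z"
    unfolding Z_def
  proof (intro continuous_on_vec_lambda continuous_on_divide continuous_on_det)
    fix k l i j
    show "continuous_on S (\<lambda>s. (\<chi> i j. if j = k then axis l 1 $ i else X s $ i $ j) $ i $ j :: real)"
      by (cases "j = k") (auto intro!: continuous_intros X)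
  qed (auto intro!: continuous_intros X simp: nz)
  ultimately show ?thesis
    by (simp cong: continuous_on_cong)
qed

text \<open>The differential equation controls only the first argument. Continuity in the second
  follows because \<open>\<Psi> t s\<close> is a right inverse of \<open>\<Psi> s t\<close>, which
  is continuous in \<open>s\<close>. This makes the integrands measurable.\<close>

lemma principal_matrix_solution_continuous:
  fixes \<Psi> :: "real \<Rightarrow> real \<Rightarrow> real^'n^'n"
  assumes "locally_integrable L" "principal_matrix_solution L \<Psi>"
  shows "continuous_on UNIV (\<Psi> t)"
proof (rule continuous_on_right_inverse_matrix)
  show "continuous_on UNIV (\<lambda>s. \<Psi> s t)"
    using assms(2) by (intro matrix_solution_continuous[of L]) (simp add: principal_matrix_solution_def)
  show "\<Psi> s t ** \<Psi> t s = mat 1" for s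
    by (rule principal_matrix_solution_inverse[OF assms])
qed

section \<open>Exponential decay, admissible functions and norm estimates\<close>

text \<open>The reflection \<open>s \<mapsto> t - s\<close> carries the half-line
  \<open>{..t}\<close> to \<open>{0..}\<close>, where the decaying exponential is
  integrable.\<close>

lemma set_integrable_exp_decay:
  fixes t \<gamma> :: real
  assumes "\<gamma> > 0"
  shows "set_integrable lebesgue {..t} (\<lambda>s. exp (- \<gamma> * (t - s)))"
proof -
  let ?f = "\<lambda>s::real. indicat_real {0..} s * exp (- \<gamma> * s)"
  have "set_integrable lebesgue {0..} (\<lambda>s. exp (- \<gamma> * s))"
    using assms by (intro nonnegative_absolutely_integrable_1 integrable_on_exp_minus_to_infinity) auto
  then have "integrable lborel ?f"
    by (simp add: set_integrable_def integrable_completion)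
  then have "integrable lborel (\<lambda>s. ?f (t + (-1) * s))"
    by (rule lborel_integrable_real_affine) simp
  also have "(\<lambda>s. ?f (t + (-1) * s)) = (\<lambda>s. indicat_real {..t} s *\<^sub>R exp (- \<gamma> * (t - s)))"
    by (auto simp: fun_eq_iff indicator_def)
  finally show ?thesis
    by (simp add: set_integrable_def integrable_completion)
qed

text \<open>A measurable function lies below its essential supremum almost everywhere. The pointwise
  form is the one in which convex combinations and perturbations are checked.\<close>

lemma mem_admissible_iff:
  "\<xi> \<in> admissible \<longleftrightarrow> \<xi> \<in> borel_measurable lebesgue \<and> (AE s in lebesgue. norm (\<xi> s) \<le> 1)"
proof (cases "\<xi> \<in> borel_measurable lebesgue")
  case True
  then have m: "(\<lambda>s. ereal (norm (\<xi> s))) \<in> borel_measurable lebesgue" by measurable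
  show ?thesis
  proof
    assume "\<xi> \<in> admissible"
    then have "esssup lebesgue (\<lambda>s. ereal (norm (\<xi> s))) \<le> 1" by (simp add: admissible_def)
    with esssup_AE[of "\<lambda>s. ereal (norm (\<xi> s))" lebesgue]
    have "AE s in lebesgue. norm (\<xi> s) \<le> 1"
      by (auto elim!: eventually_mono dest: order_trans simp flip: one_ereal_def)
    with True show "\<xi> \<in> borel_measurable lebesgue \<and> (AE s in lebesgue. norm (\<xi> s) \<le> 1)" by simp
  next
    assume "\<xi> \<in> borel_measurable lebesgue \<and> (AE s in lebesgue. norm (\<xi> s) \<le> 1)"
    then show "\<xi> \<in> admissible"
      using m by (auto simp: admissible_def one_ereal_def intro!: esssup_I)
  qed
qed (simp add: admissible_def)

text \<open>Strict convexity of the Euclidean ball: the squared norm of the combination falls short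
  of the combination of the squared norms by
  \<open>u * (1 - u) * (norm (x - y))\<^sup>2\<close>.\<close>

lemma norm_convex_combination_eq_1_imp_eq:
  fixes x y :: "'a::real_inner"
  assumes "norm x \<le> 1" "norm y \<le> 1" "0 < u" "u < 1" "norm ((1 - u) *\<^sub>R x + u *\<^sub>R y) \<ge> 1"
  shows "x = y"
proof -
  have "(norm ((1 - u) *\<^sub>R x + u *\<^sub>R y))\<^sup>2 =
      (1 - u) * (norm x)\<^sup>2 + u * (norm y)\<^sup>2 - u * (1 - u) * (norm (x - y))\<^sup>2"
    unfolding power2_norm_eq_inner by (simp add: inner_simps inner_commute algebra_simps)
  moreover have "(norm ((1 - u) *\<^sub>R x + u *\<^sub>R y))\<^sup>2 \<ge> 1"
    using assms(5) by (simp add: one_le_power)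
  moreover have "(1 - u) * (norm x)\<^sup>2 \<le> (1 - u) * 1" "u * (norm y)\<^sup>2 \<le> u * 1"
    using assms by (intro mult_left_mono; simp add: power_le_one)+
  ultimately have "u * (1 - u) * (norm (x - y))\<^sup>2 \<le> 0" by simp
  then show ?thesis using assms by (simp add: mult_le_0_iff)
qed

text \<open>The vector \<open>v v* A\<close> is the transpose of \<open>A\<close> applied to
  \<open>v\<close>. Its squared norm is \<open>v \<bullet> (A *v (v v* A))\<close>, so
  Cauchy-Schwarz gives the bound after cancelling one factor \<open>norm (v v* A)\<close>.\<close>

lemma norm_vector_matrix_mult_le:
  fixes A :: "real^'n^'m"
  shows "norm (v v* A) \<le> onorm ((*v) A) * norm v"
proof -
  have "(norm (v v* A))\<^sup>2 = v \<bullet> (A *v (v v* A))"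
    by (simp add: power2_norm_eq_inner dot_lmul_matrix)
  also have "\<dots> \<le> norm v * (onorm ((*v) A) * norm (v v* A))"
    using onorm[OF matrix_vector_mul_bounded_linear, of A "v v* A"]
    by (intro order_trans[OF norm_cauchy_schwarz] mult_left_mono) auto
  finally have "norm (v v* A) * norm (v v* A) \<le> (onorm ((*v) A) * norm v) * norm (v v* A)"
    by (simp add: power2_eq_square mult_ac)
  then show ?thesis
    using onorm_pos_le[OF matrix_vector_mul_bounded_linear, of A]
    by (cases "norm (v v* A) = 0") (auto simp: mult_le_cancel_right)
qed

section \<open>Strict convexity of the set of integrals\<close>

text \<open>The integrable bound \<open>h\<close> makes all the integrals exist. The uniform bound
  \<open>K\<close> allows one scaling constant to keep every perturbation admissible, and
  invertibility makes the perturbations move the integral in all directions.\<close>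

lemma strictly_convex_integral_admissible:
  fixes \<Phi> :: "real \<Rightarrow> real^'n^'n" and h :: "real \<Rightarrow> real"
  assumes S: "S \<in> sets lebesgue" and \<Phi>: "\<Phi> \<in> borel_measurable lebesgue"
    and inv: "\<And>s. s \<in> S \<Longrightarrow> invertible (\<Phi> s)"
    and h: "set_integrable lebesgue S h"
    and \<Phi>_le: "\<And>s. s \<in> S \<Longrightarrow> onorm ((*v) (\<Phi> s)) \<le> h s" and h_le: "\<And>s. s \<in> S \<Longrightarrow> h s \<le> K"
    and "\<rho> > 0"
  shows "strictly_convex {\<rho> *\<^sub>R (LINT s:S|lebesgue. \<Phi> s *v \<xi> s) | \<xi>. \<xi> \<in> admissible}"
proof -
  define I where "I = (\<lambda>\<xi>. LINT s:S|lebesgue. \<Phi> s *v \<xi> s)"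
  define A where "A = {\<rho> *\<^sub>R I \<xi> | \<xi>. \<xi> \<in> admissible}"
  have meas: "(\<lambda>s. \<Phi> s *v \<xi> s) \<in> borel_measurable lebesgue" if "\<xi> \<in> borel_measurable lebesgue" for \<xi>
    by (rule borel_measurable_continuous_Pair[OF \<Phi> that])
      (auto intro!: bounded_bilinear.continuous_on[OF bounded_bilinear_matrix_vector_mult] continuous_intros)
  \<comment> \<open>The bound \<open>C\<close> is arbitrary and concerns only \<open>S\<close>:
    admissible functions use 1, the perturbations \<open>w v\<close> below use
    \<open>K * norm v\<close>.\<close>
  have int: "set_integrable lebesgue S (\<lambda>s. \<Phi> s *v \<xi> s)"
    if \<xi>: "\<xi> \<in> borel_measurable lebesgue" and b: "AE s in lebesgue. s \<in> S \<longrightarrow> norm (\<xi> s) \<le> C" for \<xi> C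
    unfolding set_integrable_def
  proof (rule Bochner_Integration.integrable_bound)
    show "integrable lebesgue (\<lambda>s. \<bar>C\<bar> * (indicator S s *\<^sub>R h s))"
      using h unfolding set_integrable_def by (rule integrable_mult_right)
    show "(\<lambda>s. indicator S s *\<^sub>R (\<Phi> s *v \<xi> s)) \<in> borel_measurable lebesgue"
      using S meas[OF \<xi>] by measurable
    show "AE s in lebesgue. norm (indicator S s *\<^sub>R (\<Phi> s *v \<xi> s)) \<le> norm (\<bar>C\<bar> * (indicator S s *\<^sub>R h s))"
      using b
    proof eventually_elim
      case (elim s)
      show ?case
      proof (cases "s \<in> S")
        case True
        have "0 \<le> h s"
          using \<Phi>_le[OF True] onorm_pos_le[OF matrix_vector_mul_bounded_linear, of "\<Phi> s"] by simp
        have "norm (\<Phi> s *v \<xi> s) \<le> onorm ((*v) (\<Phi> s)) * norm (\<xi> s)"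
          by (rule onorm) simp
        also have "\<dots> \<le> h s * \<bar>C\<bar>"
          using elim \<Phi>_le True \<open>0 \<le> h s\<close> by (intro mult_mono) auto
        finally show ?thesis using True \<open>0 \<le> h s\<close> by (simp add: abs_mult mult.commute)
      qed simp
    qed
  qed
  have adm: "\<xi> \<in> borel_measurable lebesgue" "AE s in lebesgue. norm (\<xi> s) \<le> 1"
      "set_integrable lebesgue S (\<lambda>s. \<Phi> s *v \<xi> s)" if "\<xi> \<in> admissible" for \<xi>
  proof -
    show *: "\<xi> \<in> borel_measurable lebesgue" "AE s in lebesgue. norm (\<xi> s) \<le> 1"
      using that by (simp_all add: mem_admissible_iff)
    show "set_integrable lebesgue S (\<lambda>s. \<Phi> s *v \<xi> s)"
      by (rule int[OF *(1), of 1]) (use *(2) in eventually_elim, simp)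
  qed
  have I_add: "I (\<lambda>s. \<xi> s + \<eta> s) = I \<xi> + I \<eta>"
    if "set_integrable lebesgue S (\<lambda>s. \<Phi> s *v \<xi> s)" "set_integrable lebesgue S (\<lambda>s. \<Phi> s *v \<eta> s)" for \<xi> \<eta>
    using set_integral_add(2)[OF that] by (simp add: I_def matrix_vector_right_distrib)
  have I_scale: "I (\<lambda>s. c *\<^sub>R \<xi> s) = c *\<^sub>R I \<xi>" for c \<xi>
    by (simp add: I_def matrix_vector_mult_scaleR)
  have int_scale: "set_integrable lebesgue S (\<lambda>s. \<Phi> s *v (c *\<^sub>R \<xi> s))"
    if "set_integrable lebesgue S (\<lambda>s. \<Phi> s *v \<xi> s)" for c \<xi>
    using that by (simp add: matrix_vector_mult_scaleR)
  have comb: "(\<lambda>s. u *\<^sub>R \<xi> s + v *\<^sub>R \<eta> s) \<in> admissible"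
       "I (\<lambda>s. u *\<^sub>R \<xi> s + v *\<^sub>R \<eta> s) = u *\<^sub>R I \<xi> + v *\<^sub>R I \<eta>"
    if "\<xi> \<in> admissible" "\<eta> \<in> admissible" "0 \<le> u" "0 \<le> v" "u + v = 1" for u v \<xi> \<eta>
  proof -
    note m[measurable] = adm(1)[OF that(1)] adm(1)[OF that(2)]
    have "AE s in lebesgue. norm (u *\<^sub>R \<xi> s + v *\<^sub>R \<eta> s) \<le> 1"
      using adm(2)[OF that(1)] adm(2)[OF that(2)]
    proof eventually_elim
      case (elim s)
      have "norm (u *\<^sub>R \<xi> s + v *\<^sub>R \<eta> s) \<le> u * norm (\<xi> s) + v * norm (\<eta> s)"
        using that by (intro norm_triangle_le) simp
      also have "\<dots> \<le> u * 1 + v * 1" using elim that by (intro add_mono mult_left_mono) auto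
      finally show ?case using that by simp
    qed
    then show "(\<lambda>s. u *\<^sub>R \<xi> s + v *\<^sub>R \<eta> s) \<in> admissible"
      unfolding mem_admissible_iff by (intro conjI) measurable
    show "I (\<lambda>s. u *\<^sub>R \<xi> s + v *\<^sub>R \<eta> s) = u *\<^sub>R I \<xi> + v *\<^sub>R I \<eta>"
      using that by (simp add: I_add I_scale int_scale adm(3))
  qed
  have "convex A"
  proof (rule convexI)
    fix x y :: "real^'n" and u v :: real
    assume "x \<in> A" "y \<in> A" and uv: "0 \<le> u" "0 \<le> v" "u + v = 1"
    then obtain \<xi> \<eta> where *: "\<xi> \<in> admissible" "x = \<rho> *\<^sub>R I \<xi>" "\<eta> \<in> admissible" "y = \<rho> *\<^sub>R I \<eta>"
      by (auto simp: A_def)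
    have "u *\<^sub>R x + v *\<^sub>R y = \<rho> *\<^sub>R I (\<lambda>s. u *\<^sub>R \<xi> s + v *\<^sub>R \<eta> s)"
      using * uv by (simp add: comb(2) algebra_simps)
    then show "u *\<^sub>R x + v *\<^sub>R y \<in> A"
      unfolding A_def using comb(1)[OF *(1,3) uv] by blast
  qed
  moreover have "z \<in> interior A" if xy: "x \<in> A" "y \<in> A" "x \<noteq> y" and z: "z \<in> open_segment x y" for x y z
  proof -
    obtain \<xi> \<eta> where \<xi>: "\<xi> \<in> admissible" "x = \<rho> *\<^sub>R I \<xi>" and \<eta>: "\<eta> \<in> admissible" "y = \<rho> *\<^sub>R I \<eta>"
      using xy by (auto simp: A_def)
    obtain u where u: "0 < u" "u < 1" and z_eq: "z = (1 - u) *\<^sub>R x + u *\<^sub>R y"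
      using z by (auto simp: in_segment)
    define \<zeta> where "\<zeta> = (\<lambda>s. (1 - u) *\<^sub>R \<xi> s + u *\<^sub>R \<eta> s)"
    have \<zeta>: "\<zeta> \<in> admissible" "z = \<rho> *\<^sub>R I \<zeta>"
      using comb[OF \<xi>(1) \<eta>(1), of "1 - u" u] u
      by (simp_all add: \<zeta>_def z_eq \<xi>(2) \<eta>(2) scaleR_add_right mult.commute)
    note [measurable] = adm(1)[OF \<xi>(1)] adm(1)[OF \<eta>(1)] adm(1)[OF \<zeta>(1)] \<Phi> S
    \<comment> \<open>These sets exhaust the part of \<open>S\<close> where
      \<open>norm (\<zeta> s) < 1\<close>; on \<open>E n\<close> there is room for a perturbation of
      norm \<open>1 / real (Suc n)\<close>.\<close>
    define E where "E = (\<lambda>n. {s \<in> S. norm (\<zeta> s) \<le> 1 - 1 / real (Suc n)})"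
    have E_eq: "E n = S \<inter> {s \<in> space lebesgue. norm (\<zeta> s) \<le> 1 - 1 / real (Suc n)}" for n
      by (auto simp: E_def)
    have E[measurable]: "E n \<in> sets lebesgue" for n
      unfolding E_eq by measurable
    \<comment> \<open>If all \<open>E n\<close> were null, \<open>\<zeta>\<close> would have norm at
      least 1 almost everywhere on \<open>S\<close>. Then \<open>\<xi>\<close> and
      \<open>\<eta>\<close> would agree there almost everywhere, giving
      \<open>x = y\<close>.\<close>
    have "\<exists>n. \<not> (AE s in lebesgue. s \<notin> E n)"
    proof (rule ccontr)
      assume "\<not> (\<exists>n. \<not> (AE s in lebesgue. s \<notin> E n))"
      then have "AE s in lebesgue. \<forall>n. s \<notin> E n" by (simp add: AE_all_countable)
      then have "AE s in lebesgue. s \<in> S \<longrightarrow> \<xi> s = \<eta> s"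
        using adm(2)[OF \<xi>(1)] adm(2)[OF \<eta>(1)]
      proof eventually_elim
        case (elim s)
        show ?case
        proof
          assume "s \<in> S"
          then have "norm (\<zeta> s) > 1 - inverse (real (Suc n))" for n
            using elim(1) by (auto simp: E_def not_le inverse_eq_divide)
          then have "norm (\<zeta> s) \<ge> 1"
            using reals_Archimedean[of "1 - norm (\<zeta> s)"] by (smt (verit))
          then show "\<xi> s = \<eta> s"
            using elim u by (intro norm_convex_combination_eq_1_imp_eq[of _ _ u]) (auto simp: \<zeta>_def)
        qed
      qed
      then have "I \<xi> = I \<eta>"
        unfolding I_def set_lebesgue_integral_def
        by (intro integral_cong_AE borel_measurable_integrable adm(3)[unfolded set_integrable_def] \<xi>(1) \<eta>(1))
          (auto simp: indicator_def elim!: eventually_mono)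
      then show False using \<xi> \<eta> xy(3) by simp
    qed
    then obtain n where n: "\<not> (AE s in lebesgue. s \<notin> E n)" by blast
    \<comment> \<open>The transpose of \<open>\<Phi> s\<close> turns
      \<open>v \<bullet> (\<Phi> s *v w v s)\<close> into the square of
      \<open>norm (v v* \<Phi> s)\<close> on \<open>E n\<close>.\<close>
    define w where "w = (\<lambda>v s. indicator (E n) s *\<^sub>R (v v* \<Phi> s))"
    have w_meas[measurable]: "w v \<in> borel_measurable lebesgue" for v
    proof -
      have "linear (\<lambda>A::real^'n^'n. v v* A)"
        by (rule linearI) (simp_all add: vec_eq_iff vector_matrix_mult_def sum.distrib sum_distrib_left
            distrib_left mult.left_commute)
      then have "(\<lambda>A::real^'n^'n. v v* A) \<in> borel_measurable borel"
        by (intro borel_measurable_continuous_onI linear_continuous_on) (simp add: linear_conv_bounded_linear)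
      from measurable_compose[OF \<Phi> this] show ?thesis
        unfolding w_def by measurable
    qed
    have w_le: "norm (w v s) \<le> K * norm v" if "s \<in> S" for v s
    proof -
      have "norm (v v* \<Phi> s) \<le> K * norm v"
        using \<Phi>_le[OF that] h_le[OF that]
        by (intro order_trans[OF norm_vector_matrix_mult_le] mult_right_mono) auto
      moreover from this have "0 \<le> K * norm v" by (rule order_trans[OF norm_ge_zero])
      ultimately show ?thesis by (simp add: w_def indicator_def)
    qed
    have w_int: "set_integrable lebesgue S (\<lambda>s. \<Phi> s *v w v s)" for v
      by (rule int[of _ "K * norm v"]) (auto simp: w_le)
    \<comment> \<open>The matrix of \<open>M\<close> is the integral over \<open>E n\<close> of
      \<open>\<Phi> s\<close> times its transpose. Injectivity comes from
      \<open>v \<bullet> M v\<close>, the integral of a nonnegative square.\<close>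
    define M where "M = (\<lambda>v. I (w v))"
    have "linear M"
    proof
      fix v v' :: "real^'n" and c :: real
      have "w (v + v') = (\<lambda>s. w v s + w v' s)"
        by (simp add: w_def fun_eq_iff matrix_vector_right_distrib algebra_simps flip: transpose_matrix_vector)
      then show "M (v + v') = M v + M v'"
        by (simp add: M_def I_add w_int)
      have "w (c *\<^sub>R v) = (\<lambda>s. c *\<^sub>R w v s)"
        by (simp add: w_def fun_eq_iff matrix_vector_mult_scaleR flip: transpose_matrix_vector)
      then show "M (c *\<^sub>R v) = c *\<^sub>R M v"
        by (simp add: M_def I_scale)
    qed
    moreover have "inj M"
      unfolding linear_injective_0[OF \<open>linear M\<close>]
    proof safe
      fix v assume "M v = 0"
      let ?f = "\<lambda>s. indicator S s *\<^sub>R (\<Phi> s *v w v s)"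
      have f: "integrable lebesgue ?f" using w_int by (simp add: set_integrable_def)
      have f_eq: "v \<bullet> ?f s = indicator (E n) s * (norm (v v* \<Phi> s))\<^sup>2" for s
        by (simp add: w_def indicator_def E_def matrix_vector_mult_scaleR power2_norm_eq_inner dot_lmul_matrix)
      have "(LINT s|lebesgue. v \<bullet> ?f s) = v \<bullet> M v"
        unfolding M_def I_def set_lebesgue_integral_def by (rule integral_inner_right[OF f])
      then have "(LINT s|lebesgue. v \<bullet> ?f s) = 0" using \<open>M v = 0\<close> by simp
      moreover have "AE s in lebesgue. 0 \<le> v \<bullet> ?f s"
        unfolding f_eq by simp
      ultimately have "AE s in lebesgue. v \<bullet> ?f s = 0"
        using integral_nonneg_eq_0_iff_AE[OF integrable_inner_right[OF f]] by blast
      then have "AE s in lebesgue. s \<in> E n \<longrightarrow> v v* \<Phi> s = 0"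
        unfolding f_eq by (auto elim!: eventually_mono)
      \<comment> \<open>Since \<open>E n\<close> is not null, a property valid almost everywhere on
        it holds at some point of it. Invertibility of \<open>\<Phi> s\<close> at that point forces
        \<open>v = 0\<close>.\<close>
      moreover have "\<exists>\<^sub>F s in ae_filter lebesgue. s \<in> E n"
        using n by (simp add: frequently_def)
      ultimately have "\<exists>\<^sub>F s in ae_filter lebesgue. s \<in> E n \<and> (s \<in> E n \<longrightarrow> v v* \<Phi> s = 0)"
        by (intro frequently_eventually_frequently)
      then obtain s where s: "s \<in> E n" "v v* \<Phi> s = 0"
        using frequently_ex by blast
      obtain B where "\<Phi> s ** B = mat 1"
        using inv[of s] s by (auto simp: E_def invertible_def)
      then have "v \<bullet> v = v \<bullet> (\<Phi> s *v (B *v v))"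
        by (simp add: matrix_vector_mul_assoc)
      then show "v = 0"
        using s by (simp flip: dot_lmul_matrix)
    qed
    \<comment> \<open>In finite dimension the injective linear map \<open>M\<close> is surjective,
      hence open.\<close>
    ultimately have "open (M ` T)" if "open T" for T
      using that by (simp add: open_surjective_linear_image linear_injective_imp_surjective)
    \<comment> \<open>For \<open>norm v < 1\<close> this gives
      \<open>norm (c *\<^sub>R w v s) \<le> 1 / real (Suc n)\<close>, exactly the room left on
      \<open>E n\<close>. The form \<open>\<bar>K\<bar> + 1\<close> keeps the denominator
      positive.\<close>
    define c where "c = 1 / (real (Suc n) * (\<bar>K\<bar> + 1))"
    have "c > 0" by (simp add: c_def)
    have cK: "c * (\<bar>K\<bar> + 1) = 1 / real (Suc n)" by (simp add: c_def)
    \<comment> \<open>The image of the unit ball under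
      \<open>v \<mapsto> z + (\<rho> * c) *\<^sub>R M v\<close> is an open neighbourhood of
      \<open>z\<close>. Its points are the values given by the controls
      \<open>\<zeta> s + c *\<^sub>R w v s\<close>.\<close>
    define T where "T = (\<lambda>v. z + v) ` (\<lambda>v. (\<rho> * c) *\<^sub>R v) ` M ` ball 0 1"
    have "open T"
      unfolding T_def using \<open>c > 0\<close> \<open>\<rho> > 0\<close> \<open>\<And>T. open T \<Longrightarrow> open (M ` T)\<close>
      by (intro open_translation open_scaling) auto
    moreover have "z \<in> T"
      unfolding T_def using linear_0[OF \<open>linear M\<close>] by (force simp: image_iff)
    moreover have "T \<subseteq> A"
    proof
      fix p assume "p \<in> T"
      then obtain v where v: "norm v < 1" "p = z + (\<rho> * c) *\<^sub>R M v"
        by (auto simp: T_def)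
      have "AE s in lebesgue. norm (\<zeta> s + c *\<^sub>R w v s) \<le> 1"
        using adm(2)[OF \<zeta>(1)]
      proof eventually_elim
        case (elim s)
        show ?case
        proof (cases "s \<in> E n")
          case True
          then have "s \<in> S" by (simp add: E_def)
          have "norm (w v s) \<le> \<bar>K\<bar> * 1"
            using v by (intro order_trans[OF w_le[OF \<open>s \<in> S\<close>]] mult_mono) auto
          then have "c * norm (w v s) \<le> c * (\<bar>K\<bar> + 1)"
            using \<open>c > 0\<close> by (intro mult_left_mono) auto
          then have "norm (c *\<^sub>R w v s) \<le> 1 / real (Suc n)"
            using \<open>c > 0\<close> cK by simp
          moreover have "norm (\<zeta> s) \<le> 1 - 1 / real (Suc n)"
            using True by (simp add: E_def)
          ultimately show ?thesis by (intro norm_triangle_le) linarith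
        next
          case False
          then show ?thesis using elim by (simp add: w_def)
        qed
      qed
      then have "(\<lambda>s. \<zeta> s + c *\<^sub>R w v s) \<in> admissible"
        unfolding mem_admissible_iff by (intro conjI) measurable
      moreover have "p = \<rho> *\<^sub>R I (\<lambda>s. \<zeta> s + c *\<^sub>R w v s)"
        using v \<zeta> by (simp add: I_add I_scale int_scale adm(3) w_int M_def scaleR_add_right)
      ultimately show "p \<in> A" unfolding A_def by blast
    qed
    ultimately show "z \<in> interior A" by (meson interiorI)
  qed
  ultimately show ?thesis
    unfolding strictly_convex_def A_def I_def by blast
qed

section \<open>Exponentially stable systems\<close>

theorem corollary4p9:
  fixes L :: "real \<Rightarrow> real^'n^'n"
    and \<Psi> :: "real \<Rightarrow> real \<Rightarrow> real^'n^'n"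
    and \<rho> :: real
    and A :: "real \<Rightarrow> (real^'n) set"
  assumes "CARD('n) \<ge> 2"
    and "\<rho> > 0"
    and "locally_integrable L"
    and "principal_matrix_solution L \<Psi>"
    and "exponentially_stable \<Psi>"
    and "\<And>t. A t = {\<rho> *\<^sub>R (LINT s:{..t}|lebesgue. \<Psi> t s *v \<xi> s) | \<xi>. \<xi> \<in> admissible}"
  shows "\<forall>t. strictly_convex (A t)"
proof
  fix t
  note \<Psi> = \<open>locally_integrable L\<close> \<open>principal_matrix_solution L \<Psi>\<close>
  obtain K \<gamma> where "K \<ge> 1" "\<gamma> > 0"
    and K: "\<And>s. s \<le> t \<Longrightarrow> onorm ((*v) (\<Psi> t s)) \<le> K * exp (- \<gamma> * (t - s))"
    using \<open>exponentially_stable \<Psi>\<close> unfolding exponentially_stable_def by blast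
  show "strictly_convex (A t)"
    unfolding assms(6)
  \<comment> \<open>Here \<open>S\<close> is \<open>{..t}\<close>, \<open>\<Phi>\<close> is
    \<open>\<Psi> t\<close>, and \<open>h\<close> is the bound from exponential stability, which is
    integrable on \<open>{..t}\<close> and at most \<open>K\<close> there.\<close>
  proof (rule strictly_convex_integral_admissible)
    show "\<Psi> t \<in> borel_measurable lebesgue"
      using principal_matrix_solution_continuous[OF \<Psi>]
      by (intro measurable_completion) (simp add: borel_measurable_continuous_onI)
    show "invertible (\<Psi> t s)" for s
      unfolding invertible_def using principal_matrix_solution_inverse[OF \<Psi>] by blast
    show "set_integrable lebesgue {..t} (\<lambda>s. K * exp (- \<gamma> * (t - s)))"
      using set_integrable_exp_decay[OF \<open>\<gamma> > 0\<close>] by simp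
    show "K * exp (- \<gamma> * (t - s)) \<le> K" if "s \<in> {..t}" for s
      using that \<open>K \<ge> 1\<close> \<open>\<gamma> > 0\<close> by simp
  qed (use \<open>\<rho> > 0\<close> K in auto)
qed

end
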